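(* $\mathfrak{T}_1$ is complete with respect to the metric $\eta$.
   Context: $\mathbb{R}_+^*$ denotes the set of positive reals. $\mathfrak{T}_1=\{(A_1,A_2,A_3)\in(\mathbb{R}_+^* )^3:(A_1+A_2+A_3)A_1A_2A_3=1\}$ (the space of marked unit area Euclidean triangles). The metric $\eta$ on $\mathfrak{T}_1$ (not symmetric) is $\eta((A_1,A_2,A_3),(A_1',A_2',A_3'))=\log\max\{A_1'/A_1,A_2'/A_2,A_3'/A_3\}$. A (not necessarily symmetric) metric space $(X,d)$ has the convergence-symmetry property if for any two sequences $(p_n)$, $(q_n)$ in $X$ with $d(p_n,q_n)\to0$ one also has $d(q_n,p_n)\to0$; $(\mathfrak{T}_1,\eta)$ has this property. In a metric space with this property, a sequence $(x_n)$ is Cauchy if for every $\epsilon>0$ there is $N$ with $d(x_n,x_m)<\epsilon$ for all $n,m\ge N$ (equivalently, it is forward Cauchy: for every $\epsilon>0$ there is $N$ with $d(x_i,x_{i+k})<\epsilon$ for all $i\ge N$, $k\ge0$); $(x_n)$ converges to $x$ if $d(x_n,x)\to0$ (equivalently $d(x,x_n)\to0$); and the space is complete if every Cauchy sequence converges to some point. *)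

theory Defs
  imports Complex_Main
begin

text \<open>
  Metrics are not assumed symmetric here, so the library's \<open>metric_space\<close> class and its
  \<open>Cauchy\<close> and \<open>complete\<close> do not apply. The notions below take an explicit carrier \<open>X\<close> and
  distance \<open>d\<close>; they are the ones used for spaces with the convergence-symmetry property
  (\<open>d (p n) (q n) \<longlonglongrightarrow> 0\<close> implies \<open>d (q n) (p n) \<longlonglongrightarrow> 0\<close>), where forward and backward
  convergence agree.
\<close>

definition asym_Cauchy :: "('a \<Rightarrow> 'a \<Rightarrow> real) \<Rightarrow> (nat \<Rightarrow> 'a) \<Rightarrow> bool" where
  "asym_Cauchy d x \<longleftrightarrow> (\<forall>\<epsilon>>0. \<exists>N. \<forall>n\<ge>N. \<forall>m\<ge>N. d (x n) (x m) < \<epsilon>)"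

definition asym_converges :: "('a \<Rightarrow> 'a \<Rightarrow> real) \<Rightarrow> (nat \<Rightarrow> 'a) \<Rightarrow> 'a \<Rightarrow> bool" where
  "asym_converges d x l \<longleftrightarrow> (\<lambda>n. d (x n) l) \<longlonglongrightarrow> 0"

definition asym_complete :: "'a set \<Rightarrow> ('a \<Rightarrow> 'a \<Rightarrow> real) \<Rightarrow> bool" where
  "asym_complete X d \<longleftrightarrow>
     (\<forall>x. (\<forall>n. x n \<in> X) \<and> asym_Cauchy d x \<longrightarrow> (\<exists>l\<in>X. asym_converges d x l))"

definition \<TT>\<^sub>1 :: "(real \<times> real \<times> real) set" where
  "\<TT>\<^sub>1 = {(A1, A2, A3). 0 < A1 \<and> 0 < A2 \<and> 0 < A3 \<and> (A1 + A2 + A3) * A1 * A2 * A3 = 1}"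

fun \<eta> :: "real \<times> real \<times> real \<Rightarrow> real \<times> real \<times> real \<Rightarrow> real" where
  "\<eta> (A1, A2, A3) (B1, B2, B3) = ln (Max {B1 / A1, B2 / A2, B3 / A3})"

end

theory Submission
  imports Defs
begin

text \<open>
  The distance \<open>\<eta>\<close> dominates every difference of logarithms of corresponding coordinates. Applied
  in both directions, the Cauchy condition therefore makes the logarithm of each coordinate a real
  Cauchy sequence, so the coordinates converge to positive limits. The area equation passes to
  the limit.
\<close>

lemma ln_diff_le_\<eta>:
  assumes "0 < A1" "0 < A2" "0 < A3" "0 < B1" "0 < B2" "0 < B3"
  shows "ln B1 - ln A1 \<le> \<eta> (A1, A2, A3) (B1, B2, B3)"
    and "ln B2 - ln A2 \<le> \<eta> (A1, A2, A3) (B1, B2, B3)"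
    and "ln B3 - ln A3 \<le> \<eta> (A1, A2, A3) (B1, B2, B3)"
proof -
  let ?S = "{B1 / A1, B2 / A2, B3 / A3}"
  have le: "ln r \<le> \<eta> (A1, A2, A3) (B1, B2, B3)" if "r \<in> ?S" for r
  proof -
    have "0 < r" using that assms by auto
    moreover have "r \<le> Max ?S" using that by (intro Max_ge) auto
    \<comment> \<open>\<open>ln\<close> is monotone on positive reals. \<open>Max\<close> stays
      folded so that the bound on \<open>r\<close> matches the unfolded \<eta>.\<close>
    ultimately show ?thesis by (simp del: Max_insert)
  qed
  show "ln B1 - ln A1 \<le> \<eta> (A1, A2, A3) (B1, B2, B3)"
    using le[of "B1 / A1"] assms by (simp add: ln_div del: \<eta>.simps)
  show "ln B2 - ln A2 \<le> \<eta> (A1, A2, A3) (B1, B2, B3)"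
    using le[of "B2 / A2"] assms by (simp add: ln_div del: \<eta>.simps)
  show "ln B3 - ln A3 \<le> \<eta> (A1, A2, A3) (B1, B2, B3)"
    using le[of "B3 / A3"] assms by (simp add: ln_div del: \<eta>.simps)
qed

text \<open>Passing to logarithms keeps the limit away from 0, which plain convergence of positive
  reals would not. With \<open>d\<close> and \<open>x\<close> arbitrary, the lemma serves all three
  coordinates.\<close>

lemma asym_Cauchy_imp_convergent_pos:
  fixes a :: "nat \<Rightarrow> real"
  assumes "asym_Cauchy d x" and pos: "\<And>n. 0 < a n"
    and le: "\<And>n m. ln (a m) - ln (a n) \<le> d (x n) (x m)"
  obtains l where "0 < l" "a \<longlonglongrightarrow> l"
proof -
  have "Cauchy (\<lambda>n. ln (a n))"
  proof (rule CauchyI)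
    fix e :: real assume "0 < e"
    then obtain N where N: "\<And>n m. n \<ge> N \<Longrightarrow> m \<ge> N \<Longrightarrow> d (x n) (x m) < e"
      using assms(1) unfolding asym_Cauchy_def by blast
    \<comment> \<open>Since \<open>d\<close> need not be symmetric, each sign of the difference is
      bounded by the distance in one of the two orders.\<close>
    have "norm (ln (a m) - ln (a n)) < e" if "m \<ge> N" "n \<ge> N" for m n
      using N[OF that] N[OF that(2,1)] le[of m n] le[of n m] by (simp add: abs_less_iff)
    then show "\<exists>M. \<forall>m\<ge>M. \<forall>n\<ge>M. norm (ln (a m) - ln (a n)) < e" by blast
  qed
  then obtain L where "(\<lambda>n. ln (a n)) \<longlonglongrightarrow> L"
    by (auto simp: Cauchy_convergent_iff convergent_def)
  then have "(\<lambda>n. exp (ln (a n))) \<longlonglongrightarrow> exp L" by (rule tendsto_exp)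
  then have "a \<longlonglongrightarrow> exp L" using pos by simp
  then show thesis using that exp_gt_zero by blast
qed

theorem theorem8p4:
  shows "asym_complete \<TT>\<^sub>1 \<eta>"
  unfolding asym_complete_def
proof (intro allI impI, elim conjE)
  fix x assume X: "\<forall>n. x n \<in> \<TT>\<^sub>1" and C: "asym_Cauchy \<eta> x"
  define a b c where "a n = fst (x n)" and "b n = fst (snd (x n))" and "c n = snd (snd (x n))" for n
  have x: "x n = (a n, b n, c n)" for n by (simp add: a_def b_def c_def)
  have pos: "0 < a n" "0 < b n" "0 < c n"
    and area: "(a n + b n + c n) * a n * b n * c n = 1" for n
    using X[rule_format, of n] by (auto simp: x \<TT>\<^sub>1_def)
  have le: "ln (a m) - ln (a n) \<le> \<eta> (x n) (x m)" "ln (b m) - ln (b n) \<le> \<eta> (x n) (x m)"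
    "ln (c m) - ln (c n) \<le> \<eta> (x n) (x m)" for n m
    unfolding x by (intro ln_diff_le_\<eta> pos)+
  obtain A1 where A1: "0 < A1" "a \<longlonglongrightarrow> A1"
    using asym_Cauchy_imp_convergent_pos[OF C pos(1) le(1)] .
  obtain A2 where A2: "0 < A2" "b \<longlonglongrightarrow> A2"
    using asym_Cauchy_imp_convergent_pos[OF C pos(2) le(2)] .
  obtain A3 where A3: "0 < A3" "c \<longlonglongrightarrow> A3"
    using asym_Cauchy_imp_convergent_pos[OF C pos(3) le(3)] .
  have "(\<lambda>n. (a n + b n + c n) * a n * b n * c n) \<longlonglongrightarrow> (A1 + A2 + A3) * A1 * A2 * A3"
    by (intro tendsto_intros A1 A2 A3)
  \<comment> \<open>By \<open>area\<close> the sequence is constantly 1, and limits are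
    unique.\<close>
  then have "(A1 + A2 + A3) * A1 * A2 * A3 = 1"
    by (simp add: area LIMSEQ_const_iff)
  then have "(A1, A2, A3) \<in> \<TT>\<^sub>1" using A1 A2 A3 by (simp add: \<TT>\<^sub>1_def)
  \<comment> \<open>The nested \<open>max\<close> is the simplified form of the \<open>Max\<close>
    in \<eta>. Positive limits make the quotients and \<open>ln\<close> continuous here; every
    limiting ratio is 1, so the limit is \<open>ln 1 = 0\<close>.\<close>
  moreover have "(\<lambda>n. ln (max (A1 / a n) (max (A2 / b n) (A3 / c n)))) \<longlonglongrightarrow>
      ln (max (A1 / A1) (max (A2 / A2) (A3 / A3)))"
    using A1 A2 A3 by (intro tendsto_ln tendsto_max tendsto_divide tendsto_const) auto
  then have "asym_converges \<eta> x (A1, A2, A3)"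
    using A1 A2 A3 by (simp add: asym_converges_def x)
  ultimately show "\<exists>l\<in>\<TT>\<^sub>1. asym_converges \<eta> x l" by blast
qed

end
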